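(* Let $\mathbf{k}$ be a commutative unital ring, $n\ge 1$, and let $L\in M_n(\mathbf{k})$ satisfy $L^2=0$. Let $\Delta_L(N)=NL\otimes L-L\otimes LN$ for $N\in M_n(\mathbf{k})$, and define, writing $\Delta_L(N)=\sum_{(N)}N_{(1)}\otimes N_{(2)}$, $$M\rhd_L N:=\sum_{(N)}N_{(1)}MN_{(2)}\qquad (M,N\in M_n(\mathbf{k})).$$ Then $(M_n(\mathbf{k}),\rhd_L)$ is a (left) pre-Lie algebra, and so $(M_n(\mathbf{k}),[-,-]_L)$ is a Lie algebra, where $$[M,N]_L:=NLML+LNLM-MLNL-LMLN.$$
   Context: A (left) pre-Lie algebra is a $\mathbf{k}$-module $A$ with a bilinear operation $\rhd$ such that $(a\rhd b)\rhd c-a\rhd(b\rhd c)=(b\rhd a)\rhd c-b\rhd(a\rhd c)$ for all $a,b,c\in A$. The bracket $[-,-]_L$ is the one obtained from $\rhd_L$ by $[M,N]_L=M\rhd_L N-N\rhd_L M$. *)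

theory Defs
  imports "Jordan_Normal_Form.Matrix" "HOL-Algebra.Free_Abelian_Groups"
begin

section \<open>Tensor products over a commutative ring\<close>

text \<open>
  The tensor product of two modules is the free abelian group on the pairs, modulo the subgroup
  generated by the usual relators. Only its additive group is kept. As a group record from
  \<open>HOL-Algebra\<close> it is written multiplicatively: \<open>\<otimes>\<close> in it is the sum of tensors and \<open>inv\<close> is the
  negative of a tensor.
\<close>

definition tensor_relators ::
    "('r, 'm) ring_scheme \<Rightarrow> ('r, 'a, 'p) module_scheme \<Rightarrow> ('r, 'b, 'q) module_scheme
      \<Rightarrow> ('a \<times> 'b \<Rightarrow>\<^sub>0 int) set"
  where "tensor_relators R A B =
    {frag_of (a \<oplus>\<^bsub>A\<^esub> a', b) - frag_of (a, b) - frag_of (a', b) | a a' b.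
       a \<in> carrier A \<and> a' \<in> carrier A \<and> b \<in> carrier B} \<union>
    {frag_of (a, b \<oplus>\<^bsub>B\<^esub> b') - frag_of (a, b) - frag_of (a, b') | a b b'.
       a \<in> carrier A \<and> b \<in> carrier B \<and> b' \<in> carrier B} \<union>
    {frag_of (r \<odot>\<^bsub>A\<^esub> a, b) - frag_of (a, r \<odot>\<^bsub>B\<^esub> b) | r a b.
       r \<in> carrier R \<and> a \<in> carrier A \<and> b \<in> carrier B}"

definition tensor_kernel ::
    "('r, 'm) ring_scheme \<Rightarrow> ('r, 'a, 'p) module_scheme \<Rightarrow> ('r, 'b, 'q) module_scheme
      \<Rightarrow> ('a \<times> 'b \<Rightarrow>\<^sub>0 int) set"
  where "tensor_kernel R A B =
    generate (free_Abelian_group (carrier A \<times> carrier B)) (tensor_relators R A B)"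

definition tensor_product ::
    "('r, 'm) ring_scheme \<Rightarrow> ('r, 'a, 'p) module_scheme \<Rightarrow> ('r, 'b, 'q) module_scheme
      \<Rightarrow> ('a \<times> 'b \<Rightarrow>\<^sub>0 int) set monoid"
  where "tensor_product R A B =
    free_Abelian_group (carrier A \<times> carrier B) Mod tensor_kernel R A B"

definition pure_tensor ::
    "('r, 'm) ring_scheme \<Rightarrow> ('r, 'a, 'p) module_scheme \<Rightarrow> ('r, 'b, 'q) module_scheme
      \<Rightarrow> 'a \<Rightarrow> 'b \<Rightarrow> ('a \<times> 'b \<Rightarrow>\<^sub>0 int) set"
  where "pure_tensor R A B a b =
    tensor_kernel R A B #>\<^bsub>free_Abelian_group (carrier A \<times> carrier B)\<^esub> frag_of (a, b)"

text \<open>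
  For a bilinear \<open>f\<close>, \<open>tensor_lift R A B C f\<close> is the induced map \<open>A \<otimes> B \<rightarrow> C\<close>, that is
  \<open>\<Sum> a\<^sub>i \<otimes> b\<^sub>i \<mapsto> \<Sum> f a\<^sub>i b\<^sub>i\<close>. It is what Sweedler notation \<open>\<Sum> f t\<^sub>(\<^sub>1\<^sub>) t\<^sub>(\<^sub>2\<^sub>)\<close> denotes.
\<close>

definition tensor_lift ::
    "('r, 'm) ring_scheme \<Rightarrow> ('r, 'a, 'p) module_scheme \<Rightarrow> ('r, 'b, 'q) module_scheme
      \<Rightarrow> ('r, 'c, 's) module_scheme \<Rightarrow> ('a \<Rightarrow> 'b \<Rightarrow> 'c) \<Rightarrow> ('a \<times> 'b \<Rightarrow>\<^sub>0 int) set \<Rightarrow> 'c"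
  where "tensor_lift R A B C f t =
    (THE c. \<exists>h \<in> hom (tensor_product R A B) (add_monoid C).
       (\<forall>a \<in> carrier A. \<forall>b \<in> carrier B. h (pure_tensor R A B a b) = f a b) \<and> h t = c)"

section \<open>Pre-Lie and Lie algebras\<close>

locale bilinear_product = module R A for R (structure) and A (structure) +
  fixes prd :: "'c \<Rightarrow> 'c \<Rightarrow> 'c"
  assumes prd_closed: "\<lbrakk>a \<in> carrier A; b \<in> carrier A\<rbrakk> \<Longrightarrow> prd a b \<in> carrier A"
    and prd_add_left: "\<lbrakk>a \<in> carrier A; b \<in> carrier A; c \<in> carrier A\<rbrakk> \<Longrightarrow>
      prd (a \<oplus>\<^bsub>A\<^esub> b) c = prd a c \<oplus>\<^bsub>A\<^esub> prd b c"
    and prd_add_right: "\<lbrakk>a \<in> carrier A; b \<in> carrier A; c \<in> carrier A\<rbrakk> \<Longrightarrow>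
      prd a (b \<oplus>\<^bsub>A\<^esub> c) = prd a b \<oplus>\<^bsub>A\<^esub> prd a c"
    and prd_smult_left: "\<lbrakk>r \<in> carrier R; a \<in> carrier A; b \<in> carrier A\<rbrakk> \<Longrightarrow>
      prd (r \<odot>\<^bsub>A\<^esub> a) b = r \<odot>\<^bsub>A\<^esub> prd a b"
    and prd_smult_right: "\<lbrakk>r \<in> carrier R; a \<in> carrier A; b \<in> carrier A\<rbrakk> \<Longrightarrow>
      prd a (r \<odot>\<^bsub>A\<^esub> b) = r \<odot>\<^bsub>A\<^esub> prd a b"

locale pre_Lie_algebra = bilinear_product +
  assumes pre_Lie: "\<lbrakk>a \<in> carrier A; b \<in> carrier A; c \<in> carrier A\<rbrakk> \<Longrightarrow>
    prd (prd a b) c \<ominus>\<^bsub>A\<^esub> prd a (prd b c) = prd (prd b a) c \<ominus>\<^bsub>A\<^esub> prd b (prd a c)"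

locale Lie_algebra = bilinear_product +
  assumes alternating: "a \<in> carrier A \<Longrightarrow> prd a a = \<zero>\<^bsub>A\<^esub>"
    and Jacobi: "\<lbrakk>a \<in> carrier A; b \<in> carrier A; c \<in> carrier A\<rbrakk> \<Longrightarrow>
      prd a (prd b c) \<oplus>\<^bsub>A\<^esub> prd b (prd c a) \<oplus>\<^bsub>A\<^esub> prd c (prd a b) = \<zero>\<^bsub>A\<^esub>"

definition commutator :: "('r, 'a, 'p) module_scheme \<Rightarrow> ('a \<Rightarrow> 'a \<Rightarrow> 'a) \<Rightarrow> 'a \<Rightarrow> 'a \<Rightarrow> 'a"
  where "commutator A prd a b = prd a b \<ominus>\<^bsub>A\<^esub> prd b a"

section \<open>Square matrices over a commutative unital ring\<close>

text \<open>
  The sort \<open>{comm_ring, comm_monoid_mult}\<close> is that of the commutative unital rings. In contrast to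
  \<open>comm_ring_1\<close> it does not exclude the zero ring, but \<open>ring_mat\<close> and \<open>module_mat\<close> do, hence the
  records below.
\<close>

definition scalar_ring :: "'k::{comm_ring, comm_monoid_mult} ring"
  where "scalar_ring = \<lparr>carrier = UNIV, mult = (*), one = 1, ring.zero = 0, add = (+)\<rparr>"

definition mat_algebra :: "nat \<Rightarrow> ('k::{comm_ring, comm_monoid_mult}, 'k mat) module"
  where "mat_algebra n =
    \<lparr>carrier = carrier_mat n n, mult = (*), one = 1\<^sub>m n, ring.zero = 0\<^sub>m n n, add = (+),
     smult = (\<cdot>\<^sub>m)\<rparr>"

abbreviation mat_tensor :: "nat \<Rightarrow> ('k::{comm_ring, comm_monoid_mult} mat \<times> 'k mat \<Rightarrow>\<^sub>0 int) set monoid"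
  where "mat_tensor n \<equiv> tensor_product scalar_ring (mat_algebra n) (mat_algebra n)"

abbreviation mat_pure_tensor :: "nat \<Rightarrow> 'k::{comm_ring, comm_monoid_mult} mat \<Rightarrow> 'k mat
    \<Rightarrow> ('k mat \<times> 'k mat \<Rightarrow>\<^sub>0 int) set"
  where "mat_pure_tensor n \<equiv> pure_tensor scalar_ring (mat_algebra n) (mat_algebra n)"

text \<open>\<open>\<Delta>\<^sub>L(N) = NL \<otimes> L - L \<otimes> LN\<close>\<close>

definition Delta :: "nat \<Rightarrow> 'k::{comm_ring, comm_monoid_mult} mat \<Rightarrow> 'k mat
    \<Rightarrow> ('k mat \<times> 'k mat \<Rightarrow>\<^sub>0 int) set"
  where "Delta n L N =
    mat_pure_tensor n (N * L) L \<otimes>\<^bsub>mat_tensor n\<^esub> inv\<^bsub>mat_tensor n\<^esub> mat_pure_tensor n L (L * N)"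

text \<open>\<open>M \<rhd>\<^sub>L N = \<Sum> N\<^sub>(\<^sub>1\<^sub>) M N\<^sub>(\<^sub>2\<^sub>)\<close>, where \<open>\<Delta>\<^sub>L(N) = \<Sum> N\<^sub>(\<^sub>1\<^sub>) \<otimes> N\<^sub>(\<^sub>2\<^sub>)\<close>\<close>

definition tri_prod :: "nat \<Rightarrow> 'k::{comm_ring, comm_monoid_mult} mat \<Rightarrow> 'k mat \<Rightarrow> 'k mat \<Rightarrow> 'k mat"
  where "tri_prod n L M N =
    tensor_lift scalar_ring (mat_algebra n) (mat_algebra n) (mat_algebra n)
      (\<lambda>X Y. X * M * Y) (Delta n L N)"

definition bracket :: "nat \<Rightarrow> 'k::{comm_ring, comm_monoid_mult} mat \<Rightarrow> 'k mat \<Rightarrow> 'k mat \<Rightarrow> 'k mat"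
  where "bracket n L = commutator (mat_algebra n) (tri_prod n L)"

end

theory Submission
  imports Defs
begin

text \<open>
  The universal property of the tensor product evaluates \<open>M \<rhd>\<^sub>L N\<close> to \<open>NLML - LMLN\<close>. Since
  \<open>L\<^sup>2 = 0\<close>, the iterated product \<open>(X \<rhd>\<^sub>L Y) \<rhd>\<^sub>L Z\<close> vanishes and
  \<open>X \<rhd>\<^sub>L (Y \<rhd>\<^sub>L Z) = -(LYLZLXL + LXLZLYL)\<close> is symmetric in \<open>X\<close> and \<open>Y\<close>, which gives the pre-Lie
  identity. The commutator of any pre-Lie product is a Lie bracket: its Jacobi sum is a signed sum of
  differences \<open>assoc(a,b,c) - assoc(b,a,c)\<close> of associators.
\<close>

section \<open>The universal property of the tensor product\<close>

context
  fixes R :: "('r, 'm) ring_scheme" (structure)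
    and A :: "('r, 'a, 'p) module_scheme"
    and B :: "('r, 'b, 'q) module_scheme"
  assumes module_A: "module R A" and module_B: "module R B"
begin

interpretation A: module R A by (rule module_A)
interpretation B: module R B by (rule module_B)

private abbreviation F :: "('a \<times> 'b \<Rightarrow>\<^sub>0 int) monoid"
  where "F \<equiv> free_Abelian_group (carrier A \<times> carrier B)"

interpretation F: comm_group F by (rule abelian_free_Abelian_group)

lemma tensor_relators_carrier: "tensor_relators R A B \<subseteq> carrier F"
proof -
  have keys: "Poly_Mapping.keys (x - y) \<subseteq> S" if "Poly_Mapping.keys x \<subseteq> S" "Poly_Mapping.keys y \<subseteq> S"
    for x y :: "'a \<times> 'b \<Rightarrow>\<^sub>0 int" and S
    using that keys_diff[of x y] by blast
  then show ?thesis
    unfolding tensor_relators_def by (auto intro!: keys)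
qed

lemma subgroup_tensor_kernel: "subgroup (tensor_kernel R A B) F"
  unfolding tensor_kernel_def by (rule F.generate_is_subgroup[OF tensor_relators_carrier])

lemma normal_tensor_kernel: "tensor_kernel R A B \<lhd> F"
  using subgroup_tensor_kernel by (simp add: F.normal_iff_subgroup)

lemma comm_group_tensor_product: "comm_group (tensor_product R A B)"
  unfolding tensor_product_def by (rule F.abelian_FactGroup[OF subgroup_tensor_kernel])

lemma pure_tensor_closed:
  assumes "a \<in> carrier A" "b \<in> carrier B"
  shows "pure_tensor R A B a b \<in> carrier (tensor_product R A B)"
  using assms unfolding pure_tensor_def tensor_product_def carrier_FactGroup by auto

text \<open>Existence half of the universal property: \<open>f\<close> extends from pairs to the
  free abelian group, the extension kills the three families of relators, and so it factors through
  the quotient. The target is only an abelian group, so scalars enter through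
  \<open>balanced\<close>, which mirrors the third family.\<close>

lemma tensor_hom_exists:
  assumes C: "abelian_group C"
    and closed: "\<And>a b. \<lbrakk>a \<in> carrier A; b \<in> carrier B\<rbrakk> \<Longrightarrow> f a b \<in> carrier C"
    and add_left: "\<And>a a' b. \<lbrakk>a \<in> carrier A; a' \<in> carrier A; b \<in> carrier B\<rbrakk> \<Longrightarrow>
      f (a \<oplus>\<^bsub>A\<^esub> a') b = f a b \<oplus>\<^bsub>C\<^esub> f a' b"
    and add_right: "\<And>a b b'. \<lbrakk>a \<in> carrier A; b \<in> carrier B; b' \<in> carrier B\<rbrakk> \<Longrightarrow>
      f a (b \<oplus>\<^bsub>B\<^esub> b') = f a b \<oplus>\<^bsub>C\<^esub> f a b'"
    and balanced: "\<And>r a b. \<lbrakk>r \<in> carrier R; a \<in> carrier A; b \<in> carrier B\<rbrakk> \<Longrightarrow>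
      f (r \<odot>\<^bsub>A\<^esub> a) b = f a (r \<odot>\<^bsub>B\<^esub> b)"
  shows "\<exists>h \<in> hom (tensor_product R A B) (add_monoid C).
    \<forall>a \<in> carrier A. \<forall>b \<in> carrier B. h (pure_tensor R A B a b) = f a b"
proof -
  interpret C: abelian_group C by (rule C)
  have image: "case_prod f ` (carrier A \<times> carrier B) \<subseteq> carrier (add_monoid C)"
    by (rule image_subsetI) (simp add: closed mem_Times_iff split_beta)
  have "\<exists>h \<in> hom F (add_monoid C). \<forall>x \<in> carrier A \<times> carrier B. h (frag_of x) = case_prod f x"
  proof (rule comm_group.free_Abelian_group_universal[OF C.a_comm_group image])
    fix h assume "h \<in> hom F (add_monoid C)"
      and "\<And>x. x \<in> carrier A \<times> carrier B \<Longrightarrow> h (frag_of x) = case_prod f x"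
    then show ?thesis by (intro bexI[of _ h] ballI)
  qed
  then obtain h where h: "h \<in> hom F (add_monoid C)"
    and h_of: "\<And>x. x \<in> carrier A \<times> carrier B \<Longrightarrow> h (frag_of x) = case_prod f x"
    by metis
  interpret h: group_hom F "add_monoid C" h
    using h by unfold_locales
  \<comment> \<open>The relators use the subtraction of formal sums, whereas \<open>h\<close> is
    known to respect only the product and \<open>inv\<close> of \<open>F\<close>.\<close>
  have h_diff: "h (x - y) = h x \<ominus>\<^bsub>C\<^esub> h y" if "x \<in> carrier F" "y \<in> carrier F" for x y
    using h.hom_mult[OF that(1) F.inv_closed[OF that(2)]] h.hom_inv[OF that(2)] that
    by (simp add: a_minus_def a_inv_def)
  have diff_closed: "x - y \<in> carrier F" if "x \<in> carrier F" "y \<in> carrier F" for x y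
    using F.m_closed[OF that(1) F.inv_closed[OF that(2)]] that by simp
  \<comment> \<open>Images of the relators under \<open>h\<close>: the two additivity families take
    the shape in \<open>cancel\<close>, the scalar family that in
    \<open>cancel_self\<close>.\<close>
  have cancel: "(x \<oplus>\<^bsub>C\<^esub> y) \<ominus>\<^bsub>C\<^esub> x \<ominus>\<^bsub>C\<^esub> y = \<zero>\<^bsub>C\<^esub>" if "x \<in> carrier C" "y \<in> carrier C" for x y
    using that C.r_neg[of "x \<oplus>\<^bsub>C\<^esub> y"] by (simp add: C.minus_eq C.minus_add C.a_assoc)
  have cancel_self: "x \<ominus>\<^bsub>C\<^esub> x = \<zero>\<^bsub>C\<^esub>" if "x \<in> carrier C" for x
    using that by (simp add: C.minus_eq C.r_neg)
  have "tensor_relators R A B \<subseteq> kernel F (add_monoid C) h"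
  proof
    fix z assume z: "z \<in> tensor_relators R A B"
    \<comment> \<open>Membership in the carrier of \<open>F\<close> must not be unfolded into a
      condition on keys, since \<open>diff_closed\<close> has to discharge the premises of
      \<open>h_diff\<close>.\<close>
    have "h z = \<zero>\<^bsub>C\<^esub>"
      using z unfolding tensor_relators_def
      by (auto simp: h_diff diff_closed h_of add_left add_right balanced closed cancel cancel_self
          simp del: carrier_free_Abelian_group_iff)
    then show "z \<in> kernel F (add_monoid C) h"
      using z tensor_relators_carrier unfolding kernel_def
        by (simp add: subset_iff del: carrier_free_Abelian_group_iff)
  qed
  then have kernel: "tensor_kernel R A B \<subseteq> kernel F (add_monoid C) h"
    unfolding tensor_kernel_def
    by (rule F.generate_subgroup_incl[OF _ h.subgroup_kernel])
  show ?thesis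
  proof (rule FactGroup_universal[OF h normal_tensor_kernel])
    fix x y assume xy: "x \<in> carrier F" "y \<in> carrier F"
      and eq: "tensor_kernel R A B #>\<^bsub>F\<^esub> x = tensor_kernel R A B #>\<^bsub>F\<^esub> y"
    \<comment> \<open>The factorisation requires \<open>h\<close> to be constant on cosets:
      representatives of one coset differ by an element \<open>k\<close> that \<open>h\<close> sends
      to zero.\<close>
    have "x \<in> tensor_kernel R A B #>\<^bsub>F\<^esub> y"
      using F.rcos_self[OF xy(1) subgroup_tensor_kernel] eq by simp
    then obtain k where k: "k \<in> tensor_kernel R A B" "x = k \<otimes>\<^bsub>F\<^esub> y"
      unfolding r_coset_def by auto
    then have "k \<in> carrier F" "h k = \<zero>\<^bsub>C\<^esub>"
      using kernel unfolding kernel_def by auto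
    then show "h x = h y"
      using h.hom_mult[of k y] k(2) xy(2) h.hom_closed[OF xy(2)] by simp
  next
    fix g assume "g \<in> hom (F Mod tensor_kernel R A B) (add_monoid C)"
      and "\<And>x. x \<in> carrier F \<Longrightarrow> g (tensor_kernel R A B #>\<^bsub>F\<^esub> x) = h x"
    then show ?thesis
      unfolding tensor_product_def by (intro bexI[of _ g]) (auto simp: pure_tensor_def h_of)
  qed
qed

text \<open>Uniqueness half. Both maps are pulled back along the quotient map \<open>?q\<close> to
  the free abelian group, all of whose elements arise from generators by taking differences; on
  generators the pullbacks are values at pure tensors.\<close>

lemma tensor_hom_unique:
  assumes H: "group H"
    and g: "g \<in> hom (tensor_product R A B) H" and h: "h \<in> hom (tensor_product R A B) H"
    and eq: "\<And>a b. \<lbrakk>a \<in> carrier A; b \<in> carrier B\<rbrakk> \<Longrightarrow>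
      g (pure_tensor R A B a b) = h (pure_tensor R A B a b)"
    and t: "t \<in> carrier (tensor_product R A B)"
  shows "g t = h t"
proof -
  let ?q = "\<lambda>x. tensor_kernel R A B #>\<^bsub>F\<^esub> x"
  have q: "?q \<in> hom F (tensor_product R A B)"
    unfolding tensor_product_def by (rule normal.r_coset_hom_Mod[OF normal_tensor_kernel])
  interpret g: group_hom F H "g \<circ> ?q"
    by (intro group_hom.intro group_hom_axioms.intro F.is_group H Group.hom_compose[OF q g])
  interpret h: group_hom F H "h \<circ> ?q"
    by (intro group_hom.intro group_hom_axioms.intro F.is_group H Group.hom_compose[OF q h])
  obtain x where x: "Poly_Mapping.keys x \<subseteq> carrier A \<times> carrier B" "t = ?q x"
    using t unfolding tensor_product_def carrier_FactGroup by auto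
  from x(1) have "(g \<circ> ?q) x = (h \<circ> ?q) x"
  proof (rule free_Abelian_group_induct)
    show "(g \<circ> ?q) 0 = (h \<circ> ?q) 0"
      using g.hom_one h.hom_one by simp
  next
    fix x y :: "'a \<times> 'b \<Rightarrow>\<^sub>0 int"
    assume "Poly_Mapping.keys x \<subseteq> carrier A \<times> carrier B" "Poly_Mapping.keys y \<subseteq> carrier A \<times> carrier B"
      and "(g \<circ> ?q) x = (h \<circ> ?q) x" "(g \<circ> ?q) y = (h \<circ> ?q) y"
    then show "(g \<circ> ?q) (x - y) = (h \<circ> ?q) (x - y)"
      using g.hom_mult[of x "inv\<^bsub>F\<^esub> y"] h.hom_mult[of x "inv\<^bsub>F\<^esub> y"] g.hom_inv[of y] h.hom_inv[of y]
      by simp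
  next
    fix z assume "z \<in> carrier A \<times> carrier B"
    then show "(g \<circ> ?q) (frag_of z) = (h \<circ> ?q) (frag_of z)"
      using eq by (auto simp: pure_tensor_def)
  qed
  then show ?thesis using x(2) by simp
qed

text \<open>Discharges the definite description. It describes the value at \<open>t\<close> and not
  the homomorphism, because homomorphisms are total functions, unconstrained off the carrier; their
  uniqueness on the carrier suffices.\<close>

lemma tensor_lift_eq:
  assumes C: "abelian_group C"
    and h: "h \<in> hom (tensor_product R A B) (add_monoid C)"
    and h_pure: "\<And>a b. \<lbrakk>a \<in> carrier A; b \<in> carrier B\<rbrakk> \<Longrightarrow> h (pure_tensor R A B a b) = f a b"
    and t: "t \<in> carrier (tensor_product R A B)"
  shows "tensor_lift R A B C f t = h t"
proof -
  have group: "group (add_monoid C)"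
    using abelian_group.a_group[OF C] .
  show ?thesis
    unfolding tensor_lift_def
  proof (rule the_equality)
    show "\<exists>g \<in> hom (tensor_product R A B) (add_monoid C).
        (\<forall>a \<in> carrier A. \<forall>b \<in> carrier B. g (pure_tensor R A B a b) = f a b) \<and> g t = h t"
      using h h_pure by blast
    fix c
    assume "\<exists>g \<in> hom (tensor_product R A B) (add_monoid C).
        (\<forall>a \<in> carrier A. \<forall>b \<in> carrier B. g (pure_tensor R A B a b) = f a b) \<and> g t = c"
    then obtain g where g: "g \<in> hom (tensor_product R A B) (add_monoid C)"
      "\<forall>a \<in> carrier A. \<forall>b \<in> carrier B. g (pure_tensor R A B a b) = f a b" "g t = c"
      by blast
    show "c = h t"
      using tensor_hom_unique[OF group g(1) h _ t] g(2,3) h_pure by simp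
  qed
qed

text \<open>Covers the shape of \<open>Delta\<close>, a difference of two pure tensors: the lift
  agrees with a homomorphism, which preserves that difference.\<close>

lemma tensor_lift_diff:
  assumes C: "abelian_group C"
    and closed: "\<And>a b. \<lbrakk>a \<in> carrier A; b \<in> carrier B\<rbrakk> \<Longrightarrow> f a b \<in> carrier C"
    and add_left: "\<And>a a' b. \<lbrakk>a \<in> carrier A; a' \<in> carrier A; b \<in> carrier B\<rbrakk> \<Longrightarrow>
      f (a \<oplus>\<^bsub>A\<^esub> a') b = f a b \<oplus>\<^bsub>C\<^esub> f a' b"
    and add_right: "\<And>a b b'. \<lbrakk>a \<in> carrier A; b \<in> carrier B; b' \<in> carrier B\<rbrakk> \<Longrightarrow>
      f a (b \<oplus>\<^bsub>B\<^esub> b') = f a b \<oplus>\<^bsub>C\<^esub> f a b'"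
    and balanced: "\<And>r a b. \<lbrakk>r \<in> carrier R; a \<in> carrier A; b \<in> carrier B\<rbrakk> \<Longrightarrow>
      f (r \<odot>\<^bsub>A\<^esub> a) b = f a (r \<odot>\<^bsub>B\<^esub> b)"
    and ab: "a \<in> carrier A" "b \<in> carrier B" "a' \<in> carrier A" "b' \<in> carrier B"
  shows "tensor_lift R A B C f
      (pure_tensor R A B a b \<otimes>\<^bsub>tensor_product R A B\<^esub>
        inv\<^bsub>tensor_product R A B\<^esub> pure_tensor R A B a' b') = f a b \<ominus>\<^bsub>C\<^esub> f a' b'"
proof -
  obtain h where h: "h \<in> hom (tensor_product R A B) (add_monoid C)"
    and h_pure: "\<And>a b. \<lbrakk>a \<in> carrier A; b \<in> carrier B\<rbrakk> \<Longrightarrow> h (pure_tensor R A B a b) = f a b"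
    using tensor_hom_exists[of C f, OF C closed add_left add_right balanced] by blast
  interpret T: comm_group "tensor_product R A B" by (rule comm_group_tensor_product)
  interpret C: abelian_group C by (rule C)
  interpret h: group_hom "tensor_product R A B" "add_monoid C" h
    using h by unfold_locales
  show ?thesis
    using ab h.hom_mult h.hom_inv
    by (simp add: tensor_lift_eq[OF C h h_pure] pure_tensor_closed h_pure a_minus_def a_inv_def)
qed

end

section \<open>The commutator of a pre-Lie algebra\<close>

text \<open>The Jacobi sum expands by bilinearity into twelve products, which regroup into six
  associators that \<open>pre_Lie\<close> equates in pairs. The other Lie axioms follow from
  bilinearity and from \<open>x - x = 0\<close>.\<close>

lemma (in pre_Lie_algebra) Lie_algebra_commutator: "Lie_algebra R A (commutator A prd)"
proof -
  have prd_minus_left: "prd (a \<ominus>\<^bsub>A\<^esub> b) c = prd a c \<ominus>\<^bsub>A\<^esub> prd b c"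
    if "a \<in> carrier A" "b \<in> carrier A" "c \<in> carrier A" for a b c
  proof -
    have "prd (a \<ominus>\<^bsub>A\<^esub> b) c \<oplus>\<^bsub>A\<^esub> prd b c = prd a c"
      using that prd_add_left[of "a \<ominus>\<^bsub>A\<^esub> b" b c] by (simp add: M.minus_eq M.a_assoc M.l_neg)
    from this[symmetric] show ?thesis
      using that prd_closed by (simp add: M.minus_eq M.a_assoc M.r_neg)
  qed
  have prd_minus_right: "prd c (a \<ominus>\<^bsub>A\<^esub> b) = prd c a \<ominus>\<^bsub>A\<^esub> prd c b"
    if "a \<in> carrier A" "b \<in> carrier A" "c \<in> carrier A" for a b c
  proof -
    have "prd c (a \<ominus>\<^bsub>A\<^esub> b) \<oplus>\<^bsub>A\<^esub> prd c b = prd c a"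
      using that prd_add_right[of c "a \<ominus>\<^bsub>A\<^esub> b" b] by (simp add: M.minus_eq M.a_assoc M.l_neg)
    from this[symmetric] show ?thesis
      using that prd_closed by (simp add: M.minus_eq M.a_assoc M.r_neg)
  qed
  \<comment> \<open>The \<open>x\<close> are the right-nested and the \<open>y\<close> the
    left-nested products: \<open>y1 - x1\<close> up to \<open>y6 - x6\<close> are the associators of
    \<open>(a,b,c)\<close>, \<open>(a,c,b)\<close>, \<open>(b,c,a)\<close>, \<open>(b,a,c)\<close>,
    \<open>(c,a,b)\<close>, \<open>(c,b,a)\<close>. Thus \<open>eq\<close> lists three instances of
    the pre-Lie identity.\<close>
  have cyclic: "(x1 \<ominus>\<^bsub>A\<^esub> x2 \<ominus>\<^bsub>A\<^esub> (y3 \<ominus>\<^bsub>A\<^esub> y6)) \<oplus>\<^bsub>A\<^esub> (x3 \<ominus>\<^bsub>A\<^esub> x4 \<ominus>\<^bsub>A\<^esub> (y5 \<ominus>\<^bsub>A\<^esub> y2)) \<oplus>\<^bsub>A\<^esub>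
      (x5 \<ominus>\<^bsub>A\<^esub> x6 \<ominus>\<^bsub>A\<^esub> (y1 \<ominus>\<^bsub>A\<^esub> y4)) = \<zero>\<^bsub>A\<^esub>" (is "?lhs = _")
    if cl: "x1 \<in> carrier A" "x2 \<in> carrier A" "x3 \<in> carrier A" "x4 \<in> carrier A" "x5 \<in> carrier A" "x6 \<in> carrier A"
      "y1 \<in> carrier A" "y2 \<in> carrier A" "y3 \<in> carrier A" "y4 \<in> carrier A" "y5 \<in> carrier A" "y6 \<in> carrier A"
      and eq: "y1 \<ominus>\<^bsub>A\<^esub> x1 = y4 \<ominus>\<^bsub>A\<^esub> x4" "y3 \<ominus>\<^bsub>A\<^esub> x3 = y6 \<ominus>\<^bsub>A\<^esub> x6" "y5 \<ominus>\<^bsub>A\<^esub> x5 = y2 \<ominus>\<^bsub>A\<^esub> x2"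
    for x1 x2 x3 x4 x5 x6 y1 y2 y3 y4 y5 y6
  proof -
    have "?lhs = ((y4 \<ominus>\<^bsub>A\<^esub> x4) \<ominus>\<^bsub>A\<^esub> (y1 \<ominus>\<^bsub>A\<^esub> x1)) \<oplus>\<^bsub>A\<^esub> ((y6 \<ominus>\<^bsub>A\<^esub> x6) \<ominus>\<^bsub>A\<^esub> (y3 \<ominus>\<^bsub>A\<^esub> x3)) \<oplus>\<^bsub>A\<^esub>
        ((y2 \<ominus>\<^bsub>A\<^esub> x2) \<ominus>\<^bsub>A\<^esub> (y5 \<ominus>\<^bsub>A\<^esub> x5))"
      using cl by (simp add: M.minus_eq M.minus_add M.a_ac)
    then show ?thesis
      using cl eq by (simp add: M.minus_eq M.r_neg)
  qed
  show ?thesis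
  proof unfold_locales
    fix a b c assume "a \<in> carrier A" "b \<in> carrier A" "c \<in> carrier A"
    then show "commutator A prd a (commutator A prd b c) \<oplus>\<^bsub>A\<^esub> commutator A prd b (commutator A prd c a)
        \<oplus>\<^bsub>A\<^esub> commutator A prd c (commutator A prd a b) = \<zero>\<^bsub>A\<^esub>"
      unfolding commutator_def
      \<comment> \<open>The expansion has exactly the shape of \<open>cyclic\<close>, so
        \<open>intro\<close> reads off the twelve products and leaves closure goals and the three
        identities.\<close>
      by (simp add: prd_minus_left prd_minus_right prd_closed, intro cyclic)
        (simp_all add: prd_closed, (rule pre_Lie; assumption)+)
  next
    fix a b c assume "a \<in> carrier A" "b \<in> carrier A" "c \<in> carrier A"
    then show "commutator A prd (a \<oplus>\<^bsub>A\<^esub> b) c = commutator A prd a c \<oplus>\<^bsub>A\<^esub> commutator A prd b c"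
      and "commutator A prd a (b \<oplus>\<^bsub>A\<^esub> c) = commutator A prd a b \<oplus>\<^bsub>A\<^esub> commutator A prd a c"
      by (simp_all add: commutator_def prd_closed prd_add_left prd_add_right M.minus_eq M.minus_add M.a_ac)
  next
    fix r a b assume "r \<in> carrier R" "a \<in> carrier A" "b \<in> carrier A"
    then show "commutator A prd (r \<odot>\<^bsub>A\<^esub> a) b = r \<odot>\<^bsub>A\<^esub> commutator A prd a b"
      and "commutator A prd a (r \<odot>\<^bsub>A\<^esub> b) = r \<odot>\<^bsub>A\<^esub> commutator A prd a b"
      by (simp_all add: commutator_def prd_closed prd_smult_left prd_smult_right M.minus_eq
          smult_r_distr smult_r_minus)
  qed (simp_all add: commutator_def prd_closed M.minus_eq M.r_neg)
qed

section \<open>The matrix algebra\<close>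

lemma mat_algebra_simps [simp]:
  "carrier (mat_algebra n) = carrier_mat n n"
  "add (mat_algebra n) = (+)"
  "ring.zero (mat_algebra n) = 0\<^sub>m n n"
  "smult (mat_algebra n) = (\<cdot>\<^sub>m)"
  by (simp_all add: mat_algebra_def)

lemma scalar_ring_simps [simp]:
  "carrier scalar_ring = UNIV" "mult scalar_ring = (*)" "one scalar_ring = 1"
  "ring.zero scalar_ring = 0" "add scalar_ring = (+)"
  by (simp_all add: scalar_ring_def)

lemma cring_scalar_ring: "cring (scalar_ring :: 'k::{comm_ring, comm_monoid_mult} ring)"
proof (rule cringI)
  show "abelian_group (scalar_ring :: 'k ring)"
    by (rule abelian_groupI) (auto simp: ac_simps intro: exI[of _ "- _"])
  show "comm_monoid (scalar_ring :: 'k ring)"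
    by (rule comm_monoidI) (auto simp: ac_simps)
qed (simp add: algebra_simps)

lemma module_mat_algebra:
  "module scalar_ring (mat_algebra n :: ('k::{comm_ring, comm_monoid_mult}, 'k mat) module)"
proof (rule moduleI)
  show "abelian_group (mat_algebra n :: ('k, 'k mat) module)"
  proof (rule abelian_groupI)
    fix X :: "'k mat" assume "X \<in> carrier (mat_algebra n)"
    then show "\<exists>Y \<in> carrier (mat_algebra n). Y \<oplus>\<^bsub>mat_algebra n\<^esub> X = \<zero>\<^bsub>mat_algebra n\<^esub>"
      by (intro bexI[of _ "- X"]) auto
  qed (auto simp: comm_add_mat[of _ n n])
qed (auto simp: cring_scalar_ring intro!: eq_matI simp: algebra_simps)

text \<open>Negation in the record is a definite description of an additive inverse; uniqueness of
  inverses identifies it with the entrywise negative.\<close>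

lemma minus_mat_algebra:
  fixes X Y :: "'k::{comm_ring, comm_monoid_mult} mat"
  assumes "X \<in> carrier_mat n n" "Y \<in> carrier_mat n n"
  shows "X \<ominus>\<^bsub>mat_algebra n\<^esub> Y = X - Y"
proof -
  interpret module scalar_ring "mat_algebra n :: ('k, 'k mat) module" by (rule module_mat_algebra)
  have "\<ominus>\<^bsub>mat_algebra n\<^esub> Y = - Y"
    by (rule M.minus_equality) (use assms in auto)
  then show ?thesis
    using assms by (simp add: M.minus_eq add_uminus_minus_mat[of _ n n])
qed

text \<open>The map taking \<open>X\<close> and \<open>Y\<close> to \<open>X * M * Y\<close> is
  bilinear, so the lift may be evaluated on the two terms of \<open>Delta\<close>. Every later
  computation uses this closed form.\<close>

lemma tri_prod_eq:
  fixes L M N :: "'k::{comm_ring, comm_monoid_mult} mat"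
  assumes [simp]: "L \<in> carrier_mat n n" "M \<in> carrier_mat n n" "N \<in> carrier_mat n n"
  shows "tri_prod n L M N = N * L * M * L - L * M * L * N"
proof -
  note mat = module_mat_algebra[of n, where ?'k = 'k]
  note [simp] = mult_carrier_mat[of _ n n _ n]
  show ?thesis
    unfolding tri_prod_def Delta_def
    by (subst tensor_lift_diff[OF mat mat module.axioms(2)[OF mat]])
      (simp_all add: minus_mat_algebra assoc_mult_mat[of _ n n _ n _ n]
        add_mult_distrib_mat[of _ n n _ _ n] mult_add_distrib_mat[of _ n n _ n]
        mult_smult_distrib[of _ n n _ n] mult_smult_assoc_mat[of _ n n _ n])
qed

theorem theorem3p6:
  fixes n :: nat
    and L :: "'k::{comm_ring, comm_monoid_mult} mat"
  assumes "n \<ge> 1"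
    and "L \<in> carrier_mat n n"
    and "L * L = 0\<^sub>m n n"
  shows "pre_Lie_algebra scalar_ring (mat_algebra n) (tri_prod n L)
    \<and> Lie_algebra scalar_ring (mat_algebra n) (bracket n L)
    \<and> (\<forall>M \<in> carrier_mat n n. \<forall>N \<in> carrier_mat n n.
        bracket n L M N =
          N * L * M * L + L * N * L * M - M * L * N * L - L * M * L * N)"
proof (intro conjI ballI)
  note [simp] = assms(2) mult_carrier_mat[of _ n n _ n] minus_carrier_mat[of _ n n]
  note zero = left_mult_zero_mat[of _ n n n] right_mult_zero_mat[of _ n n n]
  note assoc = assoc_mult_mat[of _ n n _ n _ n]
  note distribs = add_mult_distrib_mat[of _ n n _ _ n] mult_add_distrib_mat[of _ n n _ n]
    minus_mult_distrib_mat[of _ n n _ _ n] mult_minus_distrib_mat[of _ n n _ n]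
    mult_smult_distrib[of _ n n _ n] mult_smult_assoc_mat[of _ n n _ n]
  \<comment> \<open>Once products are nested to the right, an inner \<open>L * L\<close> appears
    only in this form.\<close>
  have LLX: "L * (L * X) = 0\<^sub>m n n" if "X \<in> carrier_mat n n" for X
    using assoc[of L L X] that assms(3) by simp
  interpret mat: module scalar_ring "mat_algebra n :: ('k, 'k mat) module"
    by (rule module_mat_algebra)
  \<comment> \<open>Each term of \<open>tri_prod n L X Y\<close> begins or ends with
    \<open>L\<close>, so multiplying it by \<open>L\<close> on both sides gives zero, and both terms
    of the outer product contain that expression.\<close>
  have tri_tri_left: "tri_prod n L (tri_prod n L X Y) Z = 0\<^sub>m n n"
    if "X \<in> carrier_mat n n" "Y \<in> carrier_mat n n" "Z \<in> carrier_mat n n" for X Y Z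
    using that by (simp add: tri_prod_eq assoc distribs LLX zero assms(3))
  have tri_tri_right: "tri_prod n L X (tri_prod n L Y Z) =
      - (L * Y * L * Z * L * X * L + L * X * L * Z * L * Y * L)"
    if "X \<in> carrier_mat n n" "Y \<in> carrier_mat n n" "Z \<in> carrier_mat n n" for X Y Z
  proof -
    \<comment> \<open>\<open>A\<close> and \<open>D\<close> stand for
      \<open>Z * L * Y * L * L * X * L\<close> and \<open>L * X * L * L * Y * L * Z\<close>, the two
      terms that contain the square of \<open>L\<close>.\<close>
    have "A - B - (C - D) = - (B + C)" if "A = 0\<^sub>m n n" "D = 0\<^sub>m n n"
      "B \<in> carrier_mat n n" "C \<in> carrier_mat n n" for A B C D :: "'k mat"
      using that by (intro eq_matI) auto
    then show ?thesis
      using that by (simp add: tri_prod_eq assoc distribs LLX zero assms(3))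
  qed
  \<comment> \<open>Bilinearity of the two-term closed form comes down to this regrouping and to
    \<open>smult_diff\<close>.\<close>
  have add_diff_add: "(A + B) - (C + D) = (A - C) + (B - D)"
    if "A \<in> carrier_mat n n" "B \<in> carrier_mat n n" "C \<in> carrier_mat n n" "D \<in> carrier_mat n n"
    for A B C D :: "'k mat"
    using that by (intro eq_matI) auto
  have smult_diff: "r \<cdot>\<^sub>m (A - B) = r \<cdot>\<^sub>m A - r \<cdot>\<^sub>m B"
    if "A \<in> carrier_mat n n" "B \<in> carrier_mat n n" for A B :: "'k mat" and r
    using that by (intro eq_matI) (auto simp: right_diff_distrib)
  show "pre_Lie_algebra scalar_ring (mat_algebra n) (tri_prod n L)"
  proof unfold_locales
    fix X Y Z :: "'k mat"
    assume XYZ: "X \<in> carrier (mat_algebra n)" "Y \<in> carrier (mat_algebra n)" "Z \<in> carrier (mat_algebra n)"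
    show "tri_prod n L (X \<oplus>\<^bsub>mat_algebra n\<^esub> Y) Z =
        tri_prod n L X Z \<oplus>\<^bsub>mat_algebra n\<^esub> tri_prod n L Y Z"
      using XYZ by (simp add: tri_prod_eq assoc distribs add_diff_add)
    show "tri_prod n L X (Y \<oplus>\<^bsub>mat_algebra n\<^esub> Z) =
        tri_prod n L X Y \<oplus>\<^bsub>mat_algebra n\<^esub> tri_prod n L X Z"
      using XYZ by (simp add: tri_prod_eq assoc distribs add_diff_add)
    show "tri_prod n L (tri_prod n L X Y) Z \<ominus>\<^bsub>mat_algebra n\<^esub> tri_prod n L X (tri_prod n L Y Z) =
        tri_prod n L (tri_prod n L Y X) Z \<ominus>\<^bsub>mat_algebra n\<^esub> tri_prod n L Y (tri_prod n L X Z)"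
      \<comment> \<open>Exchanging \<open>X\<close> and \<open>Y\<close> only swaps the two summands
        in \<open>tri_tri_right\<close>.\<close>
      using XYZ by (simp add: tri_tri_left tri_tri_right comm_add_mat[of _ n n])
  next
    fix r :: 'k and X Y :: "'k mat"
    assume XY: "X \<in> carrier (mat_algebra n)" "Y \<in> carrier (mat_algebra n)"
    show "tri_prod n L (r \<odot>\<^bsub>mat_algebra n\<^esub> X) Y = r \<odot>\<^bsub>mat_algebra n\<^esub> tri_prod n L X Y"
      using XY by (simp add: tri_prod_eq assoc distribs smult_diff)
    show "tri_prod n L X (r \<odot>\<^bsub>mat_algebra n\<^esub> Y) = r \<odot>\<^bsub>mat_algebra n\<^esub> tri_prod n L X Y"
      using XY by (simp add: tri_prod_eq assoc distribs smult_diff)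
  qed (simp add: tri_prod_eq)
  then show "Lie_algebra scalar_ring (mat_algebra n) (bracket n L)"
    unfolding bracket_def by (rule pre_Lie_algebra.Lie_algebra_commutator)
  fix M N :: "'k mat" assume MN: "M \<in> carrier_mat n n" "N \<in> carrier_mat n n"
  \<comment> \<open>Reorders the expanded commutator, with \<open>A - B\<close> from
    \<open>tri_prod n L M N\<close> and \<open>C - D\<close> from
    \<open>tri_prod n L N M\<close>.\<close>
  have "A - B - (C - D) = A + D - C - B"
    if "A \<in> carrier_mat n n" "B \<in> carrier_mat n n" "C \<in> carrier_mat n n" "D \<in> carrier_mat n n"
    for A B C D :: "'k mat"
    using that by (intro eq_matI) auto
  then show "bracket n L M N = N * L * M * L + L * N * L * M - M * L * N * L - L * M * L * N"
    using MN by (simp add: bracket_def commutator_def minus_mat_algebra tri_prod_eq)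
qed

end
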